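(* Let $\mathcal{X}$ be a set, let $\mathcal{U}$ and $\mathcal{V}$ be two sets paired by a coupling $c : \mathcal{U}\times\mathcal{V}\to\overline{\mathbb{R}}$, and let $L : \mathcal{X}\times\mathcal{V}\to\overline{\mathbb{R}}$ and $R : \mathcal{X}\times\mathcal{U}\to\overline{\mathbb{R}}$ be two functions. Then the following are equivalent. \begin{enumerate} \item The functions $L$ and $R$ form a Lagrangian-Rockafellian couple $(L,R)$. \item The following equalities hold: $$L(x,v)=\inf_{u\in\mathcal{U}}\Big( R(x,u) \overset{\cdot}{+} \big(-c(u,v)\big)\Big)\quad \forall (x,v)\in\mathcal{X}\times\mathcal{V},$$ $$R(x,u)=\sup_{v\in\mathcal{V}}\Big( L(x,v)\underset{\cdot}{+} c(u,v)\Big)\quad \forall (x,u)\in\mathcal{X}\times\mathcal{U}.$$ \item $-L(x,\cdot)=\big(R(x,\cdot)\big)^{c}$ and $R(x,\cdot)=\big(-L(x,\cdot)\big)^{c'}$, for all $x\in\mathcal{X}$. \item $-L(x,\cdot)=\big(R(x,\cdot)\big)^{c}$ and $\big(R(x,\cdot)\big)^{cc'}=R(x,\cdot)$, for all $x\in\mathcal{X}$. \item $R(x,\cdot)=\big(-L(x,\cdot)\big)^{c'}$ and $\big(-L(x,\cdot)\big)^{c'c}=-L(x,\cdot)$, for all $x\in\mathcal{X}$. \end{enumerate}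
   Context: $\overline{\mathbb{R}}=[-\infty,+\infty]$. The Moreau lower addition $\underset{\cdot}{+}$ extends the usual addition to $\overline{\mathbb{R}}$ with $(+\infty)\underset{\cdot}{+}(-\infty)=(-\infty)\underset{\cdot}{+}(+\infty)=-\infty$. The Moreau upper addition $\overset{\cdot}{+}$ extends the usual addition with $(+\infty)\overset{\cdot}{+}(-\infty)=(-\infty)\overset{\cdot}{+}(+\infty)=+\infty$. A coupling between sets $\mathcal{U}$ and $\mathcal{V}$ is any function $c:\mathcal{U}\times\mathcal{V}\to\overline{\mathbb{R}}$. For $f:\mathcal{U}\to\overline{\mathbb{R}}$, the $c$-Fenchel-Moreau conjugate $f^{c}:\mathcal{V}\to\overline{\mathbb{R}}$ is $f^{c}(v)=\sup_{u\in\mathcal{U}}\big(c(u,v)\underset{\cdot}{+}(-f(u))\big)$. For $g:\mathcal{V}\to\overline{\mathbb{R}}$, the $c'$-Fenchel-Moreau conjugate $g^{c'}:\mathcal{U}\to\overline{\mathbb{R}}$ is $g^{c'}(u)=\sup_{v\in\mathcal{V}}\big(c(u,v)\underset{\cdot}{+}(-g(v))\big)$. The biconjugates are $f^{cc'}=(f^{c})^{c'}:\mathcal{U}\to\overline{\mathbb{R}}$ and $g^{c'c}=(g^{c'})^{c}:\mathcal{V}\to\overline{\mathbb{R}}$. For $x\in\mathcal{X}$, $L(x,\cdot):\mathcal{V}\to\overline{\mathbb{R}}$ and $R(x,\cdot):\mathcal{U}\to\overline{\mathbb{R}}$ denote the partial functions with $x$ fixed. Definition (Lagrangian-Rockafellian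 couple). Equip $\overline{\mathbb{R}}^{\mathcal{X}\times\mathcal{U}}\times\overline{\mathbb{R}}^{\mathcal{X}\times\mathcal{V}}$ with the natural (pointwise, componentwise) ordering. The functions $L:\mathcal{X}\times\mathcal{V}\to\overline{\mathbb{R}}$ and $R:\mathcal{X}\times\mathcal{U}\to\overline{\mathbb{R}}$ form a Lagrangian-Rockafellian couple $(L,R)$ if $(-L,R)$ is minimal in the inequality $$\big(-L(x,v)\big)\overset{\cdot}{+}R(x,u)\geq c(u,v)\quad\forall (x,u,v)\in\mathcal{X}\times\mathcal{U}\times\mathcal{V},$$ that is, $(-L,R)$ satisfies this inequality, and whenever functions $L':\mathcal{X}\times\mathcal{V}\to\overline{\mathbb{R}}$ and $R':\mathcal{X}\times\mathcal{U}\to\overline{\mathbb{R}}$ are such that $(-L',R')$ satisfies the same inequality with $-L'\leq -L$ and $R'\leq R$ pointwise, then $L'=L$ and $R'=R$. *)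

theory Defs
  imports "HOL-Library.Extended_Real"
begin

definition lower_add :: "ereal \<Rightarrow> ereal \<Rightarrow> ereal"  (infixl \<open>+\<^sub>\<bullet>\<close> 65)
  where "a +\<^sub>\<bullet> b =
    (if a = \<infinity> \<and> b = -\<infinity> \<or> a = -\<infinity> \<and> b = \<infinity> then -\<infinity> else a + b)"

text \<open>The library's addition on \<^typ>\<open>ereal\<close> already gives \<open>\<infinity> + (-\<infinity>) = \<infinity>\<close>; the case
  distinction makes the convention explicit.\<close>

definition upper_add :: "ereal \<Rightarrow> ereal \<Rightarrow> ereal"  (infixl \<open>+\<^sup>\<bullet>\<close> 65)
  where "a +\<^sup>\<bullet> b =
    (if a = \<infinity> \<and> b = -\<infinity> \<or> a = -\<infinity> \<and> b = \<infinity> then \<infinity> else a + b)"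

text \<open>The sets are explicit, possibly empty, carriers \<open>X\<close>, \<open>U\<close>, \<open>V\<close>; functions on them are total
  on the ambient types but only their values on the carriers matter. Suprema and infima are taken
  in the complete lattice \<^typ>\<open>ereal\<close>, so over the empty set they are \<open>-\<infinity>\<close> and \<open>\<infinity>\<close>.\<close>

definition conj_c :: "'u set \<Rightarrow> ('u \<Rightarrow> 'v \<Rightarrow> ereal) \<Rightarrow> ('u \<Rightarrow> ereal) \<Rightarrow> 'v \<Rightarrow> ereal"
  where "conj_c U c f v = (SUP u\<in>U. c u v +\<^sub>\<bullet> (- f u))"

definition conj_c' :: "'v set \<Rightarrow> ('u \<Rightarrow> 'v \<Rightarrow> ereal) \<Rightarrow> ('v \<Rightarrow> ereal) \<Rightarrow> 'u \<Rightarrow> ereal"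
  where "conj_c' V c g u = (SUP v\<in>V. c u v +\<^sub>\<bullet> (- g v))"

definition biconj_cc' ::
    "'u set \<Rightarrow> 'v set \<Rightarrow> ('u \<Rightarrow> 'v \<Rightarrow> ereal) \<Rightarrow> ('u \<Rightarrow> ereal) \<Rightarrow> 'u \<Rightarrow> ereal"
  where "biconj_cc' U V c f = conj_c' V c (conj_c U c f)"

definition biconj_c'c ::
    "'u set \<Rightarrow> 'v set \<Rightarrow> ('u \<Rightarrow> 'v \<Rightarrow> ereal) \<Rightarrow> ('v \<Rightarrow> ereal) \<Rightarrow> 'v \<Rightarrow> ereal"
  where "biconj_c'c U V c g = conj_c U c (conj_c' V c g)"

definition LR_inequality ::
    "'x set \<Rightarrow> 'u set \<Rightarrow> 'v set \<Rightarrow> ('u \<Rightarrow> 'v \<Rightarrow> ereal) \<Rightarrow>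
     ('x \<Rightarrow> 'v \<Rightarrow> ereal) \<Rightarrow> ('x \<Rightarrow> 'u \<Rightarrow> ereal) \<Rightarrow> bool"
  where "LR_inequality X U V c L R \<longleftrightarrow>
    (\<forall>x\<in>X. \<forall>u\<in>U. \<forall>v\<in>V. (- L x v) +\<^sup>\<bullet> R x u \<ge> c u v)"

definition LR_couple ::
    "'x set \<Rightarrow> 'u set \<Rightarrow> 'v set \<Rightarrow> ('u \<Rightarrow> 'v \<Rightarrow> ereal) \<Rightarrow>
     ('x \<Rightarrow> 'v \<Rightarrow> ereal) \<Rightarrow> ('x \<Rightarrow> 'u \<Rightarrow> ereal) \<Rightarrow> bool"
  where "LR_couple X U V c L R \<longleftrightarrow>
    LR_inequality X U V c L R \<and>
    (\<forall>L' R'. LR_inequality X U V c L' R' \<and>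
        (\<forall>x\<in>X. \<forall>v\<in>V. - L' x v \<le> - L x v) \<and>
        (\<forall>x\<in>X. \<forall>u\<in>U. R' x u \<le> R x u) \<longrightarrow>
      (\<forall>x\<in>X. \<forall>v\<in>V. L' x v = L x v) \<and>
      (\<forall>x\<in>X. \<forall>u\<in>U. R' x u = R x u))"

end

theory Submission
  imports Defs
begin

text \<open>Moreau's lower and upper additions are residuated: \<open>a \<le> b +\<^sup>\<bullet> r\<close> iff \<open>a +\<^sub>\<bullet> (-r) \<le> b\<close>,
  infinite values included. So the defining inequality of a couple says both that \<open>-L(x,\<cdot>)\<close>
  dominates the conjugate of \<open>R(x,\<cdot>)\<close> and that \<open>R(x,\<cdot>)\<close> dominates the conjugate of
  \<open>-L(x,\<cdot>)\<close>. Replacing one component by the conjugate of the other preserves the inequality, and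
  so minimality means equality in both.\<close>

lemma lower_add_commute: "a +\<^sub>\<bullet> b = b +\<^sub>\<bullet> a"
  by (auto simp: lower_add_def add.commute)

lemma upper_add_commute: "a +\<^sup>\<bullet> b = b +\<^sup>\<bullet> a"
  by (auto simp: upper_add_def add.commute)

lemma uminus_upper_add: "- (a +\<^sup>\<bullet> b) = (- a) +\<^sub>\<bullet> (- b)"
  by (cases a; cases b) (auto simp: upper_add_def lower_add_def)

lemma le_upper_add_iff: "a \<le> b +\<^sup>\<bullet> r \<longleftrightarrow> a +\<^sub>\<bullet> (- r) \<le> b"
  by (cases a; cases b; cases r) (auto simp: upper_add_def lower_add_def)

lemma LR_inequality_iff_conj_c:
  "LR_inequality X U V c L R \<longleftrightarrow> (\<forall>x\<in>X. \<forall>v\<in>V. conj_c U c (R x) v \<le> - L x v)"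
  unfolding LR_inequality_def conj_c_def SUP_le_iff le_upper_add_iff by blast

lemma LR_inequality_iff_conj_c':
  "LR_inequality X U V c L R \<longleftrightarrow>
    (\<forall>x\<in>X. \<forall>u\<in>U. conj_c' V c (\<lambda>v. - L x v) u \<le> R x u)"
  \<comment> \<open>Commuting the upper sum makes \<open>R x u\<close> the bound. The instance
    \<open>- _\<close> restricts the rewriting to sums that begin with a negation, so it cannot
    loop.\<close>
  unfolding LR_inequality_def conj_c'_def SUP_le_iff
    upper_add_commute[of "- _"] le_upper_add_iff by blast

text \<open>Raise one component at a time: in each conjugate form of the inequality, that component
  occurs only as the upper bound.\<close>

lemma LR_inequality_mono:
  assumes "LR_inequality X U V c L R"
    and "\<And>x v. x \<in> X \<Longrightarrow> v \<in> V \<Longrightarrow> - L x v \<le> - L' x v"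
    and "\<And>x u. x \<in> X \<Longrightarrow> u \<in> U \<Longrightarrow> R x u \<le> R' x u"
  shows "LR_inequality X U V c L' R'"
proof -
  have "LR_inequality X U V c L' R"
    using assms(1,2) unfolding LR_inequality_iff_conj_c by (meson order_trans)
  then show ?thesis
    using assms(3) unfolding LR_inequality_iff_conj_c' by (meson order_trans)
qed

lemma LR_couple_iff_conj:
  "LR_couple X U V c L R \<longleftrightarrow>
    (\<forall>x\<in>X. (\<forall>v\<in>V. - L x v = conj_c U c (R x) v) \<and>
           (\<forall>u\<in>U. R x u = conj_c' V c (\<lambda>v. - L x v) u))"
    (is "_ \<longleftrightarrow> ?conj")
proof
  assume couple: "LR_couple X U V c L R"
  then have ineq: "LR_inequality X U V c L R"
    and minimal: "\<And>L' R'. \<lbrakk>LR_inequality X U V c L' R';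
        \<forall>x\<in>X. \<forall>v\<in>V. - L' x v \<le> - L x v; \<forall>x\<in>X. \<forall>u\<in>U. R' x u \<le> R x u\<rbrakk> \<Longrightarrow>
      (\<forall>x\<in>X. \<forall>v\<in>V. L' x v = L x v) \<and> (\<forall>x\<in>X. \<forall>u\<in>U. R' x u = R x u)"
    unfolding LR_couple_def by blast+
  \<comment> \<open>With \<open>R\<close> kept fixed, the conjugate is the least admissible choice
    of \<open>-L\<close>; minimality leaves no gap between the two.\<close>
  let ?L = "\<lambda>x v. - conj_c U c (R x) v"
  have "LR_inequality X U V c ?L R"
    by (simp add: LR_inequality_iff_conj_c)
  then have "\<forall>x\<in>X. \<forall>v\<in>V. ?L x v = L x v"
    using minimal[of ?L R] ineq[unfolded LR_inequality_iff_conj_c] by simp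
  then have L: "\<forall>x\<in>X. \<forall>v\<in>V. - L x v = conj_c U c (R x) v"
    by (metis ereal_uminus_uminus)
  let ?R = "\<lambda>x. conj_c' V c (\<lambda>v. - L x v)"
  have "LR_inequality X U V c L ?R"
    by (simp add: LR_inequality_iff_conj_c')
  then have "\<forall>x\<in>X. \<forall>u\<in>U. ?R x u = R x u"
    using minimal[of L ?R] ineq[unfolded LR_inequality_iff_conj_c'] by simp
  with L show ?conj by simp
next
  assume conj: ?conj
  show "LR_couple X U V c L R"
    unfolding LR_couple_def
  proof (intro conjI allI impI; (elim conjE)?)
    show "LR_inequality X U V c L R"
      using conj by (simp add: LR_inequality_iff_conj_c)
  next
    fix L' R'
    assume ineq: "LR_inequality X U V c L' R'"
      and L': "\<forall>x\<in>X. \<forall>v\<in>V. - L' x v \<le> - L x v"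
      and R': "\<forall>x\<in>X. \<forall>u\<in>U. R' x u \<le> R x u"
    \<comment> \<open>Raising \<open>R'\<close> back to \<open>R\<close> isolates \<open>L'\<close>:
      now \<open>-L'\<close> bounds the conjugate of \<open>R\<close>, which is \<open>-L\<close>,
      so the assumed inequality reverses. The argument for \<open>R'\<close> is symmetric.\<close>
    have "LR_inequality X U V c L' R"
      using LR_inequality_mono[OF ineq, of L' R] R' by simp
    then have "\<forall>x\<in>X. \<forall>v\<in>V. - L x v \<le> - L' x v"
      using conj by (simp add: LR_inequality_iff_conj_c)
    with L' show "\<forall>x\<in>X. \<forall>v\<in>V. L' x v = L x v"
      by (auto intro: antisym)
    have "LR_inequality X U V c L R'"
      using LR_inequality_mono[OF ineq, of L R'] L' by simp
    then have "\<forall>x\<in>X. \<forall>u\<in>U. R x u \<le> R' x u"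
      using conj by (simp add: LR_inequality_iff_conj_c')
    with R' show "\<forall>x\<in>X. \<forall>u\<in>U. R' x u = R x u"
      by (auto intro: antisym)
  qed
qed

text \<open>Negation exchanges infimum with supremum and upper with lower addition. As it is
  injective on \<open>ereal\<close>, this makes the infimum formula for \<open>L\<close> equivalent
  to the conjugate formula for \<open>-L\<close>.\<close>

lemma conj_c_eq_uminus_INF: "conj_c U c f v = - (INF u\<in>U. f u +\<^sup>\<bullet> (- c u v))"
  by (simp add: conj_c_def ereal_SUP_uminus_eq[symmetric] uminus_upper_add lower_add_commute)

lemma conj_c'_uminus: "conj_c' V c (\<lambda>v. - l v) u = (SUP v\<in>V. l v +\<^sub>\<bullet> c u v)"
  by (simp add: conj_c'_def lower_add_commute)

text \<open>Needed because the equalities of the theorem hold on the carriers only, so one function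
  cannot simply be substituted for the other.\<close>

lemma conj_c_cong: "(\<And>u. u \<in> U \<Longrightarrow> f u = g u) \<Longrightarrow> conj_c U c f = conj_c U c g"
  by (auto simp: conj_c_def fun_eq_iff intro!: SUP_cong)

lemma conj_c'_cong: "(\<And>v. v \<in> V \<Longrightarrow> f v = g v) \<Longrightarrow> conj_c' V c f = conj_c' V c g"
  by (auto simp: conj_c'_def fun_eq_iff intro!: SUP_cong)

theorem theorem4:
  fixes X :: "'x set" and U :: "'u set" and V :: "'v set"
    and c :: "'u \<Rightarrow> 'v \<Rightarrow> ereal"
    and L :: "'x \<Rightarrow> 'v \<Rightarrow> ereal" and R :: "'x \<Rightarrow> 'u \<Rightarrow> ereal"
  shows
    "(LR_couple X U V c L R \<longleftrightarrow>
        (\<forall>x\<in>X. \<forall>v\<in>V. L x v = (INF u\<in>U. R x u +\<^sup>\<bullet> (- c u v))) \<and>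
        (\<forall>x\<in>X. \<forall>u\<in>U. R x u = (SUP v\<in>V. L x v +\<^sub>\<bullet> c u v))) \<and>
     (LR_couple X U V c L R \<longleftrightarrow>
        (\<forall>x\<in>X. (\<forall>v\<in>V. - L x v = conj_c U c (R x) v) \<and>
               (\<forall>u\<in>U. R x u = conj_c' V c (\<lambda>v. - L x v) u))) \<and>
     (LR_couple X U V c L R \<longleftrightarrow>
        (\<forall>x\<in>X. (\<forall>v\<in>V. - L x v = conj_c U c (R x) v) \<and>
               (\<forall>u\<in>U. biconj_cc' U V c (R x) u = R x u))) \<and>
     (LR_couple X U V c L R \<longleftrightarrow>
        (\<forall>x\<in>X. (\<forall>u\<in>U. R x u = conj_c' V c (\<lambda>v. - L x v) u) \<and>
               (\<forall>v\<in>V. biconj_c'c U V c (\<lambda>v. - L x v) v = - L x v)))"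
proof (intro conjI)
  show "LR_couple X U V c L R \<longleftrightarrow>
      (\<forall>x\<in>X. \<forall>v\<in>V. L x v = (INF u\<in>U. R x u +\<^sup>\<bullet> (- c u v))) \<and>
      (\<forall>x\<in>X. \<forall>u\<in>U. R x u = (SUP v\<in>V. L x v +\<^sub>\<bullet> c u v))"
    by (auto simp: LR_couple_iff_conj conj_c_eq_uminus_INF conj_c'_uminus)
  show "LR_couple X U V c L R \<longleftrightarrow>
      (\<forall>x\<in>X. (\<forall>v\<in>V. - L x v = conj_c U c (R x) v) \<and>
             (\<forall>u\<in>U. R x u = conj_c' V c (\<lambda>v. - L x v) u))"
    by (rule LR_couple_iff_conj)
  show "LR_couple X U V c L R \<longleftrightarrow>
      (\<forall>x\<in>X. (\<forall>v\<in>V. - L x v = conj_c U c (R x) v) \<and>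
             (\<forall>u\<in>U. biconj_cc' U V c (R x) u = R x u))"
    unfolding LR_couple_iff_conj biconj_cc'_def
  \<comment> \<open>Both sides share the first equality; \<open>conj_cong\<close> makes it available
    when the second conjuncts are compared.\<close>
  proof (intro ball_cong refl conj_cong)
    fix x u assume "\<forall>v\<in>V. - L x v = conj_c U c (R x) v"
    then have "conj_c' V c (\<lambda>v. - L x v) = conj_c' V c (conj_c U c (R x))"
      by (intro conj_c'_cong) simp
    then show "R x u = conj_c' V c (\<lambda>v. - L x v) u \<longleftrightarrow>
        conj_c' V c (conj_c U c (R x)) u = R x u"
      by auto
  qed
  \<comment> \<open>Here the shared equality is the one for \<open>R\<close>, the second conjunct of
    the characterization, so the equivalence under it is proved separately.\<close>
  have "- L x v = conj_c U c (R x) v \<longleftrightarrow> biconj_c'c U V c (\<lambda>v. - L x v) v = - L x v"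
    if "\<forall>u\<in>U. R x u = conj_c' V c (\<lambda>v. - L x v) u" for x v
  proof -
    have "conj_c U c (R x) = biconj_c'c U V c (\<lambda>v. - L x v)"
      unfolding biconj_c'c_def using that by (intro conj_c_cong) simp
    then show ?thesis
      by auto
  qed
  then show "LR_couple X U V c L R \<longleftrightarrow>
      (\<forall>x\<in>X. (\<forall>u\<in>U. R x u = conj_c' V c (\<lambda>v. - L x v) u) \<and>
             (\<forall>v\<in>V. biconj_c'c U V c (\<lambda>v. - L x v) v = - L x v))"
    unfolding LR_couple_iff_conj by blast
qed

end
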